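(* Let $D\subseteq X$ be a nonempty convex set and let $A,B:(D-D)\to\mathscr{P}_0(Y)$ be such that the values of the set-valued map $B$ are closedly $K$-convex, where $K:=\overline{\mathrm{rec}}(B)$. Let $F:D\to\mathscr{P}_0(Y)$ be a set-valued map which satisfies $$F\Big(\frac{x+y}{2}\Big)+A(x-y)\subseteq \mathrm{cl}\Big(\frac{F(x)+F(y)}{2}+B(x-y)\Big)\qquad (x,y\in D),$$ and has closedly $K$-convex values, i.e., $F(x)$ is closedly $K$-convex for all $x\in D$. Then, for all $x,y\in D$ and $t\in\mathbb{D}\cap[0,1]$, $$F(tx+(1-t)y)+\sum_{k=0}^{\infty}2d_{\mathbb{Z}}(2^kt)A\Big(\frac{x-y}{2^k}\Big)\subseteq \mathrm{cl}\Big(tF(x)+(1-t)F(y)+\sum_{k=0}^{\infty}2d_{\mathbb{Z}}(2^kt)B\Big(\frac{x-y}{2^k}\Big)\Big).$$ If, in addition, $0\in\mathrm{cl}(A(u)+K)$ for every $u\in D-D$, then $$F(tx+(1-t)y)+A^\perp(t,x-y)\subseteq \mathrm{cl}\big(tF(x)+(1-t)F(y)+B^\perp(t,x-y)\big)\qquad (x,y\in D,\ t\in\mathbb{D}\cap[0,1]).$$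
   Context: $X$ is a real linear space and $Y$ is a real Hausdorff topological vector space. $\mathscr{P}_0(Y)$ is the family of nonempty subsets of $Y$; $\mathrm{cl}$ is the closure in $Y$. Sums and scalar multiples of sets are in the Minkowski sense (so $0\cdot S=\{0\}$ for nonempty $S$), and $D-D=\{x-y: x,y\in D\}$. $\mathbb{D}$ is the set of diadic rationals $k/2^n$, $k\in\mathbb{Z}$, $n\in\mathbb{N}$, and $d_{\mathbb{Z}}(t):=\inf_{k\in\mathbb{Z}}|k-t|$. For $t\in\mathbb{D}$, $d_{\mathbb{Z}}(2^kt)=0$ for all large $k$, so the infinite sums of sets in the claim are in fact finite sums. Recession cones: for nonempty $S\subseteq Y$, $\mathrm{rec}(S):=\{y\in Y: ty+S\subseteq S \text{ for all } t\ge 0\}$. For a set-valued map $B$ on $D-D$, $\mathrm{rec}(B):=\bigcap_{u\in D-D}\mathrm{rec}(B(u))$, and $\overline{\mathrm{rec}}(B)$ is the closure of $\mathrm{rec}(B)$ (a convex cone containing $0$). For a convex cone $K\subseteq Y$, a set $S\subseteq Y$ is closedly $K$-convex if $tS+(1-t)S\subseteq\mathrm{cl}(S+K)$ for all $t\in[0,1]$. Tabor transformation: for a set-valued map $S:D-D\to\mathscr{P}_0(Y)$, $$S^\perp(t,u):=\mathrm{cl}\Big(\bigcup_{n=0}^\infty\sum_{k=0}^n 2d_{\mathbb{Z}}(2^kt)\,S\Big(\frac{u}{2^k}\Big)\Big)\qquad (t\in\mathbb{R},\ u\in D-D).$$ *)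

theory Defs
  imports "HOL-Analysis.Analysis" "HOL-Library.Set_Algebras" "HOL-Library.Groups_Big_Fun"
begin

text \<open>
  Real topological vector spaces, not necessarily Hausdorff. The Hausdorff property is requested
  separately by the sort \<^class>\<open>t2_space\<close>.
\<close>

class real_topological_vector = real_vector + topological_ab_group_add +
  assumes tendsto_scaleR_Pair:
    "LIM x (nhds c \<times>\<^sub>F nhds a). fst x *\<^sub>R snd x :> nhds (c *\<^sub>R a)"

instance real_normed_vector \<subseteq> real_topological_vector
proof
  fix c :: real and a :: 'a
  have "((\<lambda>x. fst x *\<^sub>R snd x) \<longlongrightarrow> fst (c, a) *\<^sub>R snd (c, a)) (nhds (c, a))"
    by (intro tendsto_scaleR tendsto_fst tendsto_snd filterlim_ident)
  then show "LIM x (nhds c \<times>\<^sub>F nhds a). fst x *\<^sub>R snd x :> nhds (c *\<^sub>R a)"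
    by (simp add: nhds_prod)
qed

text \<open>
  Minkowski addition of sets is \<open>+\<close> from \<^theory>\<open>HOL-Library.Set_Algebras\<close>, with neutral
  element \<open>0 = {0}\<close>. However, \<open>-\<close> on sets is the set-theoretic difference, hence the
  separate definition of the difference set \<open>D - D\<close>.
\<close>

abbreviation set_scaleR :: "real \<Rightarrow> 'a::real_vector set \<Rightarrow> 'a set"  (infixr \<open>*\<^sub>S\<close> 75)
  where "c *\<^sub>S S \<equiv> (\<lambda>x. c *\<^sub>R x) ` S"

definition difference_set :: "'a::ab_group_add set \<Rightarrow> 'a set"
  where "difference_set D = {x - y | x y. x \<in> D \<and> y \<in> D}"

definition dyadic_rationals :: "real set"
  where "dyadic_rationals = {of_int k / 2 ^ n | (k::int) (n::nat). True}"

definition dist_Ints :: "real \<Rightarrow> real"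
  where "dist_Ints t = (INF k::int. \<bar>of_int k - t\<bar>)"

definition rec_cone :: "'a::real_vector set \<Rightarrow> 'a set"
  where "rec_cone S = {y. \<forall>t\<ge>0. {t *\<^sub>R y} + S \<subseteq> S}"

definition rec_cone_map :: "'a::real_vector set \<Rightarrow> ('a \<Rightarrow> 'b::real_vector set) \<Rightarrow> 'b set"
  where "rec_cone_map D B = (\<Inter>u\<in>difference_set D. rec_cone (B u))"

definition closedly_convex ::
    "'b::{real_vector, topological_space} set \<Rightarrow> 'b set \<Rightarrow> bool"
  where "closedly_convex K S \<longleftrightarrow>
    (\<forall>t\<in>{0..1}. t *\<^sub>S S + (1 - t) *\<^sub>S S \<subseteq> closure (S + K))"

definition tabor_term ::
    "('a::real_vector \<Rightarrow> 'b::real_vector set) \<Rightarrow> real \<Rightarrow> 'a \<Rightarrow> nat \<Rightarrow> 'b set"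
  where "tabor_term S t u k = (2 * dist_Ints (2 ^ k * t)) *\<^sub>S S ((1 / 2 ^ k) *\<^sub>R u)"

text \<open>
  \<^const>\<open>Sum_any\<close> adds up the summands different from \<open>0 = {0}\<close>. Lemma
  \<open>finite_tabor_support\<close> below shows that there are only finitely many of these when \<open>t\<close> is
  dyadic and the values of \<open>S\<close> involved are nonempty, which is the only case of interest.
\<close>

definition tabor_sum ::
    "('a::real_vector \<Rightarrow> 'b::real_vector set) \<Rightarrow> real \<Rightarrow> 'a \<Rightarrow> 'b set"
  where "tabor_sum S t u = Sum_any (tabor_term S t u)"

definition tabor_transform ::
    "('a::real_vector \<Rightarrow> 'b::{real_vector, topological_space} set) \<Rightarrow> real \<Rightarrow> 'a \<Rightarrow> 'b set"
  where "tabor_transform S t u = closure (\<Union>n. \<Sum>k\<in>{0..n}. tabor_term S t u k)"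

lemma dist_Ints_of_int: "dist_Ints (of_int m) = 0"
proof -
  have "dist_Ints (of_int m) \<le> \<bar>of_int m - of_int m\<bar>"
    unfolding dist_Ints_def by (rule cINF_lower) (auto intro: bdd_belowI[of _ 0])
  moreover have "0 \<le> dist_Ints (of_int m)"
    unfolding dist_Ints_def by (rule cINF_greatest) auto
  ultimately show ?thesis by simp
qed

lemma finite_tabor_support:
  assumes "t \<in> dyadic_rationals" and "\<And>k::nat. S ((1 / 2 ^ k) *\<^sub>R u) \<noteq> {}"
  shows "finite {k. tabor_term S t u k \<noteq> 0}"
proof -
  obtain m :: int and n :: nat where t: "t = of_int m / 2 ^ n"
    using assms(1) unfolding dyadic_rationals_def by blast
  have zero: "tabor_term S t u k = 0" if le: "n \<le> k" for k
  proof -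
    obtain j where "k = n + j"
      using le_Suc_ex[OF le] by blast
    then have "2 ^ k * t = of_int (2 ^ j * m)"
      by (simp add: t power_add)
    then have "dist_Ints (2 ^ k * t) = 0"
      by (simp only: dist_Ints_of_int)
    then have "tabor_term S t u k = (\<lambda>x. 0) ` S ((1 / 2 ^ k) *\<^sub>R u)"
      by (simp only: tabor_term_def mult_zero_right scaleR_zero_left)
    also have "\<dots> = {0}"
      using assms(2) by (simp only: image_constant_conv if_False)
    finally show ?thesis
      by (simp only: set_zero)
  qed
  show ?thesis
  proof (rule finite_subset)
    show "{k. tabor_term S t u k \<noteq> 0} \<subseteq> {..<n}"
    proof
      fix k assume "k \<in> {k. tabor_term S t u k \<noteq> 0}"
      then have "tabor_term S t u k \<noteq> 0"
        by (rule CollectD)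
      with zero[of k] have "\<not> n \<le> k"
        by blast
      then show "k \<in> {..<n}"
        by simp
    qed
  qed (rule finite_lessThan)
qed

end

theory Submission
  imports Defs
begin

text \<open>
  Inclusions \<open>S \<subseteq> closure (T + K)\<close> form a preorder that is compatible with Minkowski sums and
  nonnegative multiples, and closed \<open>K\<close>-convexity of \<open>S\<close> says that \<open>a S + b S\<close> is below
  \<open>(a + b) S\<close>. In this preorder the inclusion for \<open>t = j / 2 ^ n\<close> follows by induction on \<open>n\<close>. The
  cone \<open>K\<close> is removed only at the end: for \<open>0 < t < 1\<close> the summand \<open>k = 0\<close> of the sum of the
  values of \<open>B\<close> has a positive coefficient and absorbs \<open>K\<close>, because \<open>B u + K \<subseteq> closure (B u)\<close>.
\<close>

section \<open>Minkowski operations and closures\<close>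

lemma set_scaleR_scaleR: "a *\<^sub>S b *\<^sub>S S = (a * b) *\<^sub>S S"
  by (simp add: image_image)

lemma set_scaleR_add: "c *\<^sub>S (S + T) = c *\<^sub>S S + c *\<^sub>S T"
  by (fastforce simp: set_plus_def image_def scaleR_add_right)

lemma set_scaleR_zero_right: "c *\<^sub>S 0 = 0"
  by (simp add: set_zero)

lemma set_scaleR_zero_left: "S \<noteq> {} \<Longrightarrow> 0 *\<^sub>S S = 0"
  by (auto simp: set_zero)

lemma set_scaleR_sum: "c *\<^sub>S sum S I = (\<Sum>i\<in>I. c *\<^sub>S S i)"
proof (induction I rule: infinite_finite_induct)
  case (insert i I)
  then show ?case by (simp add: set_scaleR_add)
qed (simp_all add: set_zero)

text \<open>Each vector of \<open>S\<close> serves in both summands. The reverse inclusion is a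
  convexity property; \<open>closedly_convex_le\<close> supplies it up to closure and cone.\<close>

lemma set_scaleR_add_left_subset: "(a + b) *\<^sub>S S \<subseteq> a *\<^sub>S S + b *\<^sub>S S"
  by (auto simp: scaleR_add_left)

lemma set_singleton_add: "{x + y} = {x} + {y}"
  by (simp add: set_plus_def)

lemma sum_set_mono: "(\<And>i. i \<in> I \<Longrightarrow> S i \<subseteq> T i) \<Longrightarrow> sum S I \<subseteq> sum T I"
  by (induction I rule: infinite_finite_induct) (simp_all add: set_plus_mono2)

text \<open>Addition is continuous, so it maps the closure of \<open>S \<times> T\<close>, which is
  \<open>closure S \<times> closure T\<close>, into the closure of the image.\<close>

lemma closure_add_subset:
  fixes S T :: "'a::topological_monoid_add set"
  shows "closure S + closure T \<subseteq> closure (S + T)"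
proof -
  have "(\<lambda>(x, y). x + y) ` closure (S \<times> T) \<subseteq> closure (S + T)"
    by (rule image_closure_subset)
      (auto simp: split_def intro!: continuous_intros subsetD[OF closure_subset])
  then show ?thesis
    by (simp add: closure_Times set_plus_image)
qed

lemma continuous_on_scaleR_topological:
  "continuous_on S (\<lambda>x::'a::real_topological_vector. c *\<^sub>R x)"
proof -
  have "((\<lambda>x. c *\<^sub>R x) \<longlongrightarrow> c *\<^sub>R a) (at a within S)" for a :: 'a
    using filterlim_compose[OF tendsto_scaleR_Pair[of c a],
        of "\<lambda>x. (c, x)" "at a within S"]
    by (simp add: filterlim_Pair tendsto_ident_at)
  then show ?thesis
    by (simp add: continuous_on_def)
qed

lemma set_scaleR_closure_subset:
  fixes S :: "'a::real_topological_vector set"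
  shows "c *\<^sub>S closure S \<subseteq> closure (c *\<^sub>S S)"
  by (rule image_closure_subset)
    (auto intro: continuous_on_scaleR_topological subsetD[OF closure_subset])

section \<open>Convex cones and recession cones\<close>

lemma convex_cone_closure_topological:
  fixes K :: "'a::real_topological_vector set"
  assumes "convex_cone K"
  shows "convex_cone (closure K)"
proof -
  have "K + K \<subseteq> K"
    using convex_cone_add[OF assms] by (auto elim: set_plus_elim)
  then have "closure K + closure K \<subseteq> closure K"
    using closure_add_subset[of K K] closure_mono by blast
  moreover have "c *\<^sub>S closure K \<subseteq> closure K" if "0 \<le> c" for c
  proof -
    have "c *\<^sub>S K \<subseteq> K"
      using convex_cone_scaleR[OF assms that] by blast
    then show ?thesis
      using set_scaleR_closure_subset[of c K] closure_mono by blast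
  qed
  moreover have "0 \<in> closure K"
    using convex_cone_contains_0[OF assms] closure_subset by blast
  ultimately show ?thesis
    unfolding convex_cone_iff by (blast intro: set_plus_intro)
qed

lemma rec_cone_add_subset: "rec_cone S + S \<subseteq> S"
proof
  fix z assume "z \<in> rec_cone S + S"
  then obtain y s where "z = y + s" "y \<in> rec_cone S" "s \<in> S"
    by (auto elim: set_plus_elim)
  moreover from this have "{1 *\<^sub>R y} + S \<subseteq> S"
    unfolding rec_cone_def by (metis (mono_tags) mem_Collect_eq zero_le_one)
  ultimately show "z \<in> S"
    by (auto intro: set_plus_intro)
qed

lemma convex_cone_rec_cone: "convex_cone (rec_cone S)"
proof -
  have "x + y \<in> rec_cone S" if "x \<in> rec_cone S" "y \<in> rec_cone S" for x y
  proof -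
    have "{t *\<^sub>R (x + y)} + S \<subseteq> S" if "0 \<le> t" for t
    proof -
      have "{t *\<^sub>R (x + y)} + S = {t *\<^sub>R x} + ({t *\<^sub>R y} + S)"
        by (simp only: scaleR_add_right set_singleton_add add.assoc[symmetric])
      also have "\<dots> \<subseteq> {t *\<^sub>R x} + S"
        using \<open>y \<in> rec_cone S\<close> \<open>0 \<le> t\<close> by (intro set_plus_mono2) (simp_all add: rec_cone_def)
      also have "\<dots> \<subseteq> S"
        using \<open>x \<in> rec_cone S\<close> \<open>0 \<le> t\<close> by (simp add: rec_cone_def)
      finally show ?thesis .
    qed
    then show ?thesis
      by (simp add: rec_cone_def)
  qed
  moreover have "c *\<^sub>R x \<in> rec_cone S" if "x \<in> rec_cone S" "0 \<le> c" for c x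
    using that by (auto simp: rec_cone_def)
  moreover have "0 \<in> rec_cone S"
    by (simp add: rec_cone_def flip: set_zero)
  ultimately show ?thesis
    by (simp add: convex_cone_iff)
qed

lemma convex_cone_rec_cone_map: "convex_cone (rec_cone_map D B)"
  unfolding rec_cone_map_def by (rule convex_cone_Inter) (auto intro: convex_cone_rec_cone)

text \<open>Recession directions translate \<open>B u\<close> into itself; limits of such directions
  translate it into its closure. This is the property by which the cone is removed at the
  end.\<close>

lemma closure_rec_cone_map_add_subset:
  fixes B :: "'a::real_vector \<Rightarrow> 'b::real_topological_vector set"
  assumes "u \<in> difference_set D"
  shows "closure (rec_cone_map D B) + B u \<subseteq> closure (B u)"
proof -
  have "rec_cone_map D B + B u \<subseteq> rec_cone (B u) + B u"
    using assms by (intro set_plus_mono2) (auto simp: rec_cone_map_def)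
  then have "rec_cone_map D B + B u \<subseteq> B u"
    using rec_cone_add_subset by blast
  moreover have "closure (rec_cone_map D B) + B u \<subseteq> closure (rec_cone_map D B + B u)"
    using set_plus_mono2[OF order_refl closure_subset] closure_add_subset by (rule order_trans)
  ultimately show ?thesis
    using closure_mono by blast
qed

text \<open>Keeps all arguments \<open>u / 2 ^ k\<close> of the Tabor terms inside
  \<open>D - D\<close>, where the assumptions on \<open>A\<close> and \<open>B\<close>
  apply.\<close>

lemma difference_set_scaleR:
  assumes "convex D" "u \<in> difference_set D" "0 \<le> c" "c \<le> 1"
  shows "c *\<^sub>R u \<in> difference_set D"
proof -
  obtain x y where u: "u = x - y" "x \<in> D" "y \<in> D"
    using assms(2) by (auto simp: difference_set_def)
  have "c *\<^sub>R x + (1 - c) *\<^sub>R y \<in> D"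
    using assms u by (intro convexD) auto
  moreover have "c *\<^sub>R u = (c *\<^sub>R x + (1 - c) *\<^sub>R y) - y"
    by (simp add: u algebra_simps)
  ultimately show ?thesis
    using u by (auto simp: difference_set_def)
qed

section \<open>The distance to the integers\<close>

text \<open>Every integer other than \<open>m\<close> is at distance at least 1 from
  \<open>m\<close>, hence at least 1/2 from \<open>x\<close>, so \<open>m\<close> is a nearest
  integer.\<close>

lemma dist_Ints_eq_abs:
  assumes "\<bar>x - of_int m\<bar> \<le> 1/2"
  shows "dist_Ints x = \<bar>x - of_int m\<bar>"
  unfolding dist_Ints_def
proof (rule antisym)
  have "(INF k::int. \<bar>of_int k - x\<bar>) \<le> \<bar>of_int m - x\<bar>"
    by (rule cINF_lower) (auto intro: bdd_belowI[of _ 0])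
  then show "(INF k::int. \<bar>of_int k - x\<bar>) \<le> \<bar>x - of_int m\<bar>"
    by (simp add: abs_minus_commute)
next
  have "\<bar>x - of_int m\<bar> \<le> \<bar>of_int k - x\<bar>" for k :: int
  proof (cases "k = m")
    case False
    then have "1 \<le> \<bar>of_int (k - m) :: real\<bar>"
      by linarith
    with assms show ?thesis
      by linarith
  qed (simp add: abs_minus_commute)
  then show "\<bar>x - of_int m\<bar> \<le> (INF k::int. \<bar>of_int k - x\<bar>)"
    by (intro cINF_greatest) auto
qed

lemma dist_Ints_nonneg: "0 \<le> dist_Ints x"
  unfolding dist_Ints_def by (rule cINF_greatest) auto

lemma dist_Ints_pos:
  assumes "0 < x" "x < 1"
  shows "0 < dist_Ints x"
  using assms dist_Ints_eq_abs[of x 0] dist_Ints_eq_abs[of x 1] by (cases "x \<le> 1/2") auto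

text \<open>Between consecutive half-integers the distance to the integers is affine: the nearest
  integer is the left endpoint for even \<open>l\<close> and the right endpoint for odd
  \<open>l\<close>.\<close>

lemma dist_Ints_midpoint:
  assumes "of_int l / 2 \<le> a" "a \<le> (of_int l + 1) / 2" "of_int l / 2 \<le> b" "b \<le> (of_int l + 1) / 2"
  shows "2 * dist_Ints ((a + b) / 2) = dist_Ints a + dist_Ints b"
proof (cases "even l")
  case True
  then obtain m where "l = 2 * m" by blast
  then show ?thesis
    using assms dist_Ints_eq_abs[of a m] dist_Ints_eq_abs[of b m] dist_Ints_eq_abs[of "(a + b) / 2" m]
    by (simp add: abs_if field_simps split: if_splits)
next
  case False
  then obtain m where "l = 2 * m + 1" by (blast elim: oddE)
  then show ?thesis
    using assms dist_Ints_eq_abs[of a "m + 1"] dist_Ints_eq_abs[of b "m + 1"]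
      dist_Ints_eq_abs[of "(a + b) / 2" "m + 1"]
    by (simp add: abs_if field_simps split: if_splits)
qed

lemma dist_Ints_dyadic_midpoint:
  fixes i :: int
  assumes "k < n"
  shows "2 * dist_Ints (2 ^ k * (of_int (2 * i + 1) / 2 ^ Suc n)) =
    dist_Ints (2 ^ k * (of_int (i + 1) / 2 ^ n)) + dist_Ints (2 ^ k * (of_int i / 2 ^ n))"
proof -
  obtain m where n: "n = Suc (k + m)"
    using assms less_iff_Suc_add by blast
  \<comment> \<open>As \<open>n = k + m + 1\<close>, the scaled neighbours are
    \<open>i / 2 ^ (m + 1)\<close> and \<open>(i + 1) / 2 ^ (m + 1)\<close>. The half-unit interval
    containing the first one has the index \<open>l\<close>, the floor of \<open>i / 2 ^ m\<close>;
    since \<open>i\<close> is an integer, the same closed interval contains the second one.\<close>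
  define l where "l = i div 2 ^ m"
  have "i = l * 2 ^ m + i mod 2 ^ m"
    unfolding l_def by (rule div_mult_mod_eq[symmetric])
  moreover have "0 \<le> i mod 2 ^ m" "i mod 2 ^ m < 2 ^ m"
    by simp_all
  ultimately have "l * 2 ^ m \<le> i" "i + 1 \<le> (l + 1) * 2 ^ m"
    by (simp_all only: distrib_right)
  then have *: "of_int l * 2 ^ m \<le> (of_int i :: real)" "of_int i + 1 \<le> (of_int l + 1) * (2 ^ m :: real)"
    by (simp_all flip: of_int_le_iff[where ?'a = real])
  have a: "2 ^ k * (of_int (i + 1) / 2 ^ n) = (of_int i + 1) / (2 * 2 ^ m :: real)"
    and b: "2 ^ k * (of_int i / 2 ^ n) = of_int i / (2 * 2 ^ m :: real)"
    and c: "2 ^ k * (of_int (2 * i + 1) / 2 ^ Suc n) =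
      ((of_int i + 1) / (2 * 2 ^ m) + of_int i / (2 * 2 ^ m :: real)) / 2"
    by (simp_all add: n power_add field_simps)
  show ?thesis
    unfolding a b c using * by (intro dist_Ints_midpoint[of l]) (simp_all add: field_simps)
qed

section \<open>Tabor sums and transformations at dyadic points\<close>

lemma tabor_term_eq_0:
  fixes j :: int
  assumes "t = of_int j / 2 ^ n" "n \<le> k" "S ((1 / 2 ^ k) *\<^sub>R u) \<noteq> {}"
  shows "tabor_term S t u k = 0"
proof -
  obtain i where "k = n + i"
    using le_Suc_ex[OF assms(2)] by blast
  then have "2 ^ k * t = of_int (2 ^ i * j)"
    by (simp add: assms(1) power_add)
  then show ?thesis
    by (simp only: tabor_term_def dist_Ints_of_int mult_zero_right set_scaleR_zero_left[OF assms(3)])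
qed

text \<open>The number \<open>m\<close> of terms is free from the level \<open>n\<close> on, since
  all further terms are \<open>{0}\<close>. Longer sums serve to compare with the transformation and
  to split off the summand \<open>k = 0\<close>.\<close>

lemma tabor_sum_eq_sum_lessThan:
  fixes j :: int
  assumes "t = of_int j / 2 ^ n" "n \<le> m" "\<And>k::nat. S ((1 / 2 ^ k) *\<^sub>R u) \<noteq> {}"
  shows "tabor_sum S t u = (\<Sum>k<m. tabor_term S t u k)"
  unfolding tabor_sum_def
proof (rule Sum_any.expand_superset)
  show "{k. tabor_term S t u k \<noteq> 0} \<subseteq> {..<m}"
  proof
    fix k assume "k \<in> {k. tabor_term S t u k \<noteq> 0}"
    with tabor_term_eq_0[OF assms(1), of k S u] assms(2,3) show "k \<in> {..<m}"
      by (cases "k < m") auto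
  qed
qed simp

lemma tabor_sum_subset_tabor_transform:
  assumes "t \<in> dyadic_rationals" "\<And>k::nat. S ((1 / 2 ^ k) *\<^sub>R u) \<noteq> {}"
  shows "tabor_sum S t u \<subseteq> tabor_transform S t u"
proof -
  obtain j :: int and n :: nat where tn: "t = of_int j / 2 ^ n"
    using assms(1) unfolding dyadic_rationals_def by blast
  have "tabor_sum S t u = (\<Sum>k<Suc n. tabor_term S t u k)"
    by (rule tabor_sum_eq_sum_lessThan[OF tn]) (simp_all add: assms(2))
  also have "\<dots> = (\<Sum>k\<in>{0..n}. tabor_term S t u k)"
    by (simp only: lessThan_Suc_atMost atMost_atLeast0)
  also have "\<dots> \<subseteq> tabor_transform S t u"
    unfolding tabor_transform_def by (rule order_trans[OF UN_upper closure_subset]) simp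
  finally show ?thesis .
qed

lemma tabor_transform_of_int:
  assumes "\<And>k::nat. S ((1 / 2 ^ k) *\<^sub>R u) \<noteq> {}"
  shows "tabor_transform S (of_int j) u = closure 0"
proof -
  have "tabor_term S (of_int j) u k = 0" for k
    by (rule tabor_term_eq_0[of _ j 0]) (simp_all add: assms)
  then show ?thesis
    by (simp only: tabor_transform_def sum.neutral_const UN_constant UNIV_not_empty if_False)
qed

section \<open>Inclusion up to closure and a convex cone\<close>

locale convex_cone_order =
  fixes K :: "'b::real_topological_vector set"
  assumes convex_cone: "convex_cone K"
begin

text \<open>The closure is built into the relation because sums of closed sets need not be closed;
  the summand \<open>K\<close> collects the errors of closed convexity.\<close>

definition le :: "'b set \<Rightarrow> 'b set \<Rightarrow> bool"  (infix \<open>\<preceq>\<close> 50)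
  where "S \<preceq> T \<longleftrightarrow> S \<subseteq> closure (T + K)"

text \<open>Lets the copies of \<open>K\<close> that arise in \<open>le_trans\<close> and
  \<open>le_add\<close> merge into one.\<close>

lemma cone_add: "K + K = K"
  using convex_cone_add[OF convex_cone] set_zero_plus2[OF convex_cone_contains_0[OF convex_cone], of K]
  by (auto elim: set_plus_elim)

lemma le_closureI: "S \<subseteq> closure T \<Longrightarrow> S \<preceq> T"
  unfolding le_def
  using closure_mono[OF set_zero_plus2[OF convex_cone_contains_0[OF convex_cone], of T]]
  by (auto simp: add.commute)

lemma leI: "S \<subseteq> T \<Longrightarrow> S \<preceq> T"
  using closure_subset by (blast intro: le_closureI)

lemma le_refl: "S \<preceq> S"
  by (simp add: leI)

lemma le_trans [trans]:
  assumes "S \<preceq> T" "T \<preceq> U"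
  shows "S \<preceq> U"
proof -
  have "T + K \<subseteq> closure (U + K) + closure K"
    using assms(2) closure_subset unfolding le_def by (rule set_plus_mono2)
  also have "\<dots> \<subseteq> closure (U + K + K)"
    by (rule closure_add_subset)
  finally have "closure (T + K) \<subseteq> closure (U + K)"
    by (simp add: add.assoc cone_add closure_minimal)
  with assms(1) show ?thesis
    by (auto simp: le_def)
qed

lemma le_closure_left: "S \<preceq> T \<Longrightarrow> closure S \<preceq> T"
  by (simp add: le_def closure_minimal)

lemma le_add:
  assumes "S \<preceq> T" "S' \<preceq> T'"
  shows "S + S' \<preceq> T + T'"
proof -
  have "S + S' \<subseteq> closure (T + K) + closure (T' + K)"
    using assms unfolding le_def by (rule set_plus_mono2)
  also have "\<dots> \<subseteq> closure ((T + K) + (T' + K))"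
    by (rule closure_add_subset)
  also have "(T + K) + (T' + K) = T + T' + (K + K)"
    by (simp only: ac_simps)
  finally show ?thesis
    by (simp add: cone_add le_def)
qed

lemma le_sum: "(\<And>i. i \<in> I \<Longrightarrow> S i \<preceq> T i) \<Longrightarrow> sum S I \<preceq> sum T I"
  by (induction I rule: infinite_finite_induct) (simp_all add: le_refl le_add)

lemma le_scaleR:
  assumes "S \<preceq> T" "0 \<le> c"
  shows "c *\<^sub>S S \<preceq> c *\<^sub>S T"
proof -
  have "c *\<^sub>S S \<subseteq> c *\<^sub>S closure (T + K)"
    using assms(1) unfolding le_def by (rule image_mono)
  also have "\<dots> \<subseteq> closure (c *\<^sub>S T + c *\<^sub>S K)"
    using set_scaleR_closure_subset[of c "T + K"] by (simp only: set_scaleR_add)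
  also have "\<dots> \<subseteq> closure (c *\<^sub>S T + K)"
    using convex_cone_scaleR[OF convex_cone assms(2)] by (intro closure_mono set_plus_mono2) auto
  finally show ?thesis
    by (simp only: le_def)
qed

text \<open>Normalising the weights to \<open>t = a / (a + b)\<close> and scaling back by
  \<open>a + b\<close> reduces this to the definition; the case \<open>a + b = 0\<close>, where both
  weights vanish, is separate.\<close>

lemma closedly_convex_le:
  assumes "closedly_convex K S" "0 \<le> a" "0 \<le> b"
  shows "a *\<^sub>S S + b *\<^sub>S S \<preceq> (a + b) *\<^sub>S S"
proof (cases "a + b = 0")
  case True
  then have "a = 0" "b = 0"
    using assms by auto
  then show ?thesis
    by (intro leI) (auto elim!: set_plus_elim)
next
  case False
  define t where "t = a / (a + b)"
  have t: "t \<in> {0..1}" "(a + b) * t = a" "(a + b) * (1 - t) = b"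
    using assms(2,3) False by (auto simp: t_def field_simps)
  have "t *\<^sub>S S + (1 - t) *\<^sub>S S \<preceq> S"
    using assms(1) t(1) unfolding closedly_convex_def le_def by blast
  from le_scaleR[OF this, of "a + b"] show ?thesis
    using assms(2,3) by (simp only: set_scaleR_add set_scaleR_scaleR t add_nonneg_nonneg)
qed

section \<open>Absorption of the cone by a summand\<close>

lemma scaleR_add_cone_subset:
  assumes "S + K \<subseteq> closure S" "0 < c"
  shows "c *\<^sub>S S + K \<subseteq> closure (c *\<^sub>S S)"
proof -
  \<comment> \<open>A positive factor maps the cone onto itself, so absorption survives scaling; for
    \<open>c = 0\<close> the set \<open>{0}\<close> would in general not absorb
    \<open>K\<close>.\<close>
  have "K \<subseteq> c *\<^sub>S K"
  proof
    fix x assume "x \<in> K"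
    then have "(1 / c) *\<^sub>R x \<in> K"
      using assms(2) by (intro convex_cone_scaleR[OF convex_cone]) auto
    then show "x \<in> c *\<^sub>S K"
      using assms(2) by (intro image_eqI[of _ _ "(1 / c) *\<^sub>R x"]) auto
  qed
  then have "c *\<^sub>S S + K \<subseteq> c *\<^sub>S (S + K)"
    unfolding set_scaleR_add by (intro set_plus_mono2 order_refl)
  also have "\<dots> \<subseteq> c *\<^sub>S closure S"
    using assms(1) by (rule image_mono)
  also have "\<dots> \<subseteq> closure (c *\<^sub>S S)"
    by (rule set_scaleR_closure_subset)
  finally show ?thesis .
qed

text \<open>One summand that absorbs \<open>K\<close> up to closure suffices to remove
  \<open>K\<close> from the whole sum.\<close>

lemma le_add_absorb:
  assumes "S \<preceq> T + U" "U + K \<subseteq> closure U"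
  shows "S \<subseteq> closure (T + U)"
proof -
  have "T + U + K \<subseteq> closure T + closure U"
    unfolding add.assoc using assms(2) closure_subset by (intro set_plus_mono2)
  also have "\<dots> \<subseteq> closure (T + U)"
    by (rule closure_add_subset)
  finally have "closure (T + U + K) \<subseteq> closure (T + U)"
    by (simp add: closure_minimal)
  with assms(1) show ?thesis
    by (auto simp: le_def)
qed

text \<open>
  A dyadic rational of level \<open>n + 1\<close> is the midpoint of two neighbours of level \<open>n\<close>, and
  \<open>\<lambda>t. dist_Ints (2 ^ k * t)\<close> is affine between these neighbours for \<open>k < n\<close>.
\<close>

lemma tabor_partial_sum_le:
  fixes A B F :: "'a::real_vector \<Rightarrow> 'b set" and j :: int
  assumes D: "convex D"
    and B_ne: "\<And>u. u \<in> difference_set D \<Longrightarrow> B u \<noteq> {}"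
    and F_ne: "\<And>x. x \<in> D \<Longrightarrow> F x \<noteq> {}"
    and B_convex: "\<And>u. u \<in> difference_set D \<Longrightarrow> closedly_convex K (B u)"
    and F_convex: "\<And>x. x \<in> D \<Longrightarrow> closedly_convex K (F x)"
    and midpoint: "\<And>x y. x \<in> D \<Longrightarrow> y \<in> D \<Longrightarrow>
      F ((1/2) *\<^sub>R (x + y)) + A (x - y) \<preceq> (1/2) *\<^sub>S (F x + F y) + B (x - y)"
    and x: "x \<in> D" and y: "y \<in> D"
    and "t = of_int j / 2 ^ n" "t \<in> {0..1}"
  shows "F (t *\<^sub>R x + (1 - t) *\<^sub>R y) + (\<Sum>k<n. tabor_term A t (x - y) k)
    \<preceq> t *\<^sub>S F x + (1 - t) *\<^sub>S F y + (\<Sum>k<n. tabor_term B t (x - y) k)"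
  using assms(9,10)
proof (induction n arbitrary: t j)
  case 0
  \<comment> \<open>At level 0 the number \<open>t\<close> is an integer and both sums are empty;
    nonempty values of \<open>F\<close> make the multiples by 0 neutral.\<close>
  then have "t = 0 \<or> t = 1"
    by auto
  then show ?case
    using set_scaleR_zero_left[OF F_ne[OF x]] set_scaleR_zero_left[OF F_ne[OF y]]
    by (auto intro!: leI)
next
  case (Suc n)
  define u where "u = x - y"
  have u: "(1 / 2 ^ k) *\<^sub>R u \<in> difference_set D" for k :: nat
    using x y by (intro difference_set_scaleR[OF D]) (auto simp: u_def difference_set_def)
  show ?case
  proof (cases "even j")
    case True
    then obtain i where "j = 2 * i" by blast
    with Suc.prems have t: "t = of_int i / 2 ^ n"
      by simp
    \<comment> \<open>\<open>t\<close> already has level \<open>n\<close>, so the additional term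
      \<open>k = n\<close> has coefficient 0 on both sides.\<close>
    then have "dist_Ints (2 ^ n * t) = 0"
      by (simp add: dist_Ints_of_int)
    then have "tabor_term A t u n \<preceq> tabor_term B t u n"
      using B_ne[OF u[of n]] by (intro leI) (auto simp: tabor_term_def)
    with Suc.IH[OF t Suc.prems(2)] show ?thesis
      unfolding sum.lessThan_Suc u_def by (simp only: le_add flip: add.assoc)
  next
    case False
    then obtain i where j: "j = 2 * i + 1" by (blast elim: oddE)
    \<comment> \<open>The neighbours of \<open>t\<close> on the grid of step
      \<open>1 / 2 ^ n\<close>, to the right and to the left.\<close>
    define s where "s = of_int (i + 1) / (2 ^ n :: real)"
    define r where "r = of_int i / (2 ^ n :: real)"
    have t: "t = of_int (2 * i + 1) / 2 ^ Suc n"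
      using Suc.prems j by simp
    have "0 \<le> (of_int (2 * i + 1) :: real)" "of_int (2 * i + 1) \<le> (2 ^ Suc n :: real)"
      using Suc.prems(2) unfolding t by (auto simp: field_simps simp del: of_int_add of_int_mult)
    \<comment> \<open>Passing to integers lets parity sharpen
      \<open>2 * i + 1 \<le> 2 ^ Suc n\<close> to \<open>i + 1 \<le> 2 ^ n\<close>, so both
      neighbours stay in the unit interval.\<close>
    then have "(of_int 0 :: real) \<le> of_int (2 * i + 1)"
        "(of_int (2 * i + 1) :: real) \<le> of_int (2 ^ Suc n)"
      by simp_all
    then have "0 \<le> 2 * i + 1" "2 * i + 1 \<le> 2 ^ Suc n"
      by (simp_all only: of_int_le_iff)
    then have "0 \<le> i" "of_int (i + 1) \<le> (of_int (2 ^ n) :: real)"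
      unfolding of_int_le_iff by auto
    then have i: "0 \<le> (of_int i :: real)" "of_int i + 1 \<le> (2 ^ n :: real)"
      by simp_all
    moreover from i have "of_int i \<le> (2 ^ n :: real)"
      by linarith
    ultimately have s01: "s \<in> {0..1}" and r01: "r \<in> {0..1}"
      by (auto simp: s_def r_def)
    have sr: "s + r = 2 * t" and sr': "s - r = 1 / 2 ^ n"
      by (simp_all add: s_def r_def t field_simps)
    define p where "p q = q *\<^sub>R x + (1 - q) *\<^sub>R y" for q :: real
    have p: "p s \<in> D" "p r \<in> D"
      unfolding p_def using D x y s01 r01 by (auto intro!: convexD)
    have pt: "p t = (1/2) *\<^sub>R (p s + p r)"
    proof -
      have t2: "t = (1/2) * (s + r)"
        using sr by simp
      show ?thesis
        unfolding p_def t2 by (simp add: algebra_simps flip: scaleR_add_left)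
    qed
    \<comment> \<open>Hence the midpoint hypothesis at \<open>p s\<close> and \<open>p r\<close>
      contributes the values of \<open>A\<close> and \<open>B\<close> at \<open>u / 2 ^ n\<close>,
      which occur in the new term \<open>k = n\<close>.\<close>
    have pd: "p s - p r = (1 / 2 ^ n) *\<^sub>R u"
      unfolding sr'[symmetric] p_def u_def by (simp add: algebra_simps)
    define SA where "SA q = (\<Sum>k<n. tabor_term A q u k)" for q
    define SB where "SB q = (\<Sum>k<n. tabor_term B q u k)" for q
    have coeff: "2 * dist_Ints (2 ^ k * t) = 1/2 * (2 * dist_Ints (2 ^ k * s)) + 1/2 * (2 * dist_Ints (2 ^ k * r))"
      if "k < n" for k
      using dist_Ints_dyadic_midpoint[OF that, of i] by (simp only: t s_def r_def)
    \<comment> \<open>\<open>2 ^ n * t\<close> is \<open>i + 1/2\<close>, where the coefficient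
      attains its maximum 1, so the new term enters unscaled.\<close>
    have "\<bar>2 ^ n * t - of_int i\<bar> = 1/2"
      by (simp add: t field_simps)
    with dist_Ints_eq_abs[of "2 ^ n * t" i] have dn: "2 * dist_Ints (2 ^ n * t) = 1"
      by simp
    have last: "tabor_term S t u n = S ((1 / 2 ^ n) *\<^sub>R u)" for S :: "'a \<Rightarrow> 'b set"
      unfolding tabor_term_def dn by simp
    \<comment> \<open>On the side of \<open>A\<close> each coefficient is split, on the side of
      \<open>B\<close> two are combined; the latter rests on closed \<open>K\<close>-convexity of
      the values.\<close>
    have SA: "SA t \<subseteq> (1/2) *\<^sub>S SA s + (1/2) *\<^sub>S SA r"
      unfolding SA_def set_scaleR_sum sum.distrib[symmetric]
    proof (rule sum_set_mono)
      fix k assume "k \<in> {..<n}"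
      then have "k < n" by simp
      show "tabor_term A t u k \<subseteq> (1/2) *\<^sub>S tabor_term A s u k + (1/2) *\<^sub>S tabor_term A r u k"
        unfolding tabor_term_def coeff[OF \<open>k < n\<close>] set_scaleR_scaleR
        by (rule set_scaleR_add_left_subset)
    qed
    have SB: "(1/2) *\<^sub>S SB s + (1/2) *\<^sub>S SB r \<preceq> SB t"
      unfolding SB_def set_scaleR_sum sum.distrib[symmetric]
    proof (rule le_sum)
      fix k assume "k \<in> {..<n}"
      then have "k < n" by simp
      show "(1/2) *\<^sub>S tabor_term B s u k + (1/2) *\<^sub>S tabor_term B r u k \<preceq> tabor_term B t u k"
        unfolding tabor_term_def coeff[OF \<open>k < n\<close>] set_scaleR_scaleR
        by (intro closedly_convex_le B_convex u mult_nonneg_nonneg dist_Ints_nonneg) simp_all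
    qed
    have Fx: "(1/2 * s) *\<^sub>S F x + (1/2 * r) *\<^sub>S F x \<preceq> t *\<^sub>S F x"
      using closedly_convex_le[OF F_convex[OF x], of "1/2 * s" "1/2 * r"] s01 r01 sr
      by (simp flip: distrib_left add_divide_distrib)
    have "1/2 * (1 - s) + 1/2 * (1 - r) = 1 - t"
      using sr by argo
    with closedly_convex_le[OF F_convex[OF y], of "1/2 * (1 - s)" "1/2 * (1 - r)"] s01 r01
    have Fy: "(1/2 * (1 - s)) *\<^sub>S F y + (1/2 * (1 - r)) *\<^sub>S F y \<preceq> (1 - t) *\<^sub>S F y"
      by auto
    have IH: "F (p q) + SA q \<preceq> q *\<^sub>S F x + (1 - q) *\<^sub>S F y + SB q" if "q = s \<or> q = r" for q
      using that Suc.IH[OF s_def s01] Suc.IH[OF r_def r01]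
      unfolding p_def SA_def SB_def u_def by metis
    \<comment> \<open>The chain splits the sum of \<open>A\<close>, applies the midpoint hypothesis,
      then the induction hypothesis at \<open>s\<close> and \<open>r\<close>, and finally merges the
      multiples of \<open>F x\<close>, of \<open>F y\<close> and of the values of
      \<open>B\<close>.\<close>
    have "F (p t) + (SA t + A ((1 / 2 ^ n) *\<^sub>R u))
      \<preceq> F (p t) + ((1/2) *\<^sub>S SA s + (1/2) *\<^sub>S SA r + A ((1 / 2 ^ n) *\<^sub>R u))"
      by (intro le_add le_refl leI[OF SA])
    also have "\<dots> = (F (p t) + A ((1 / 2 ^ n) *\<^sub>R u)) + ((1/2) *\<^sub>S SA s + (1/2) *\<^sub>S SA r)"
      by (simp only: ac_simps)
    also have "\<dots> \<preceq> ((1/2) *\<^sub>S (F (p s) + F (p r)) + B ((1 / 2 ^ n) *\<^sub>R u))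
        + ((1/2) *\<^sub>S SA s + (1/2) *\<^sub>S SA r)"
      using midpoint[OF p] unfolding pt pd by (rule le_add[OF _ le_refl])
    also have "\<dots> = (1/2) *\<^sub>S (F (p s) + SA s) + (1/2) *\<^sub>S (F (p r) + SA r) + B ((1 / 2 ^ n) *\<^sub>R u)"
      by (simp only: set_scaleR_add ac_simps)
    also have "\<dots> \<preceq> (1/2) *\<^sub>S (s *\<^sub>S F x + (1 - s) *\<^sub>S F y + SB s)
        + (1/2) *\<^sub>S (r *\<^sub>S F x + (1 - r) *\<^sub>S F y + SB r) + B ((1 / 2 ^ n) *\<^sub>R u)"
      by (intro le_add le_refl le_scaleR IH) auto
    also have "\<dots> = ((1/2 * s) *\<^sub>S F x + (1/2 * r) *\<^sub>S F x)
        + ((1/2 * (1 - s)) *\<^sub>S F y + (1/2 * (1 - r)) *\<^sub>S F y)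
        + (((1/2) *\<^sub>S SB s + (1/2) *\<^sub>S SB r) + B ((1 / 2 ^ n) *\<^sub>R u))"
      by (simp only: set_scaleR_add set_scaleR_scaleR add.assoc add.left_commute add.commute)
    also have "\<dots> \<preceq> t *\<^sub>S F x + (1 - t) *\<^sub>S F y + (SB t + B ((1 / 2 ^ n) *\<^sub>R u))"
      by (intro le_add le_refl Fx Fy SB)
    finally show ?thesis
      unfolding sum.lessThan_Suc u_def[symmetric] last by (simp only: SA_def SB_def p_def)
  qed
qed

text \<open>The condition \<open>A_0\<close> puts every term above \<open>0\<close>. Padding a
  partial sum with further terms therefore moves it up, and all sufficiently long sums equal the
  finite Tabor sum.\<close>

lemma tabor_transform_le_tabor_sum:
  fixes A :: "'a::real_vector \<Rightarrow> 'b set"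
  assumes t: "t \<in> dyadic_rationals"
    and A_ne: "\<And>k::nat. A ((1 / 2 ^ k) *\<^sub>R u) \<noteq> {}"
    and A_0: "\<And>k::nat. 0 \<in> closure (A ((1 / 2 ^ k) *\<^sub>R u) + K)"
  shows "tabor_transform A t u \<preceq> tabor_sum A t u"
proof -
  obtain j :: int and n :: nat where tn: "t = of_int j / 2 ^ n"
    using t unfolding dyadic_rationals_def by blast
  have "(\<Sum>k\<in>{0..m}. tabor_term A t u k) \<preceq> tabor_sum A t u" for m
  proof -
    \<comment> \<open>Large enough for the sum to be complete at level \<open>n\<close> and to
      include the indices up to \<open>m\<close>.\<close>
    define N where "N = max n (Suc m)"
    have "0 \<preceq> tabor_term A t u k" for k
    proof -
      have "0 \<preceq> A ((1 / 2 ^ k) *\<^sub>R u)"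
        using A_0 by (simp add: le_def set_zero)
      from le_scaleR[OF this, of "2 * dist_Ints (2 ^ k * t)"] show ?thesis
        unfolding tabor_term_def by (simp only: set_scaleR_zero_right) (simp add: dist_Ints_nonneg)
    qed
    then have "(\<Sum>k\<in>{..<N} - {0..m}. 0) + (\<Sum>k\<in>{0..m}. tabor_term A t u k)
      \<preceq> (\<Sum>k\<in>{..<N} - {0..m}. tabor_term A t u k) + (\<Sum>k\<in>{0..m}. tabor_term A t u k)"
      by (intro le_add le_sum le_refl)
    also have "\<dots> = (\<Sum>k<N. tabor_term A t u k)"
      by (rule sum.subset_diff[symmetric]) (auto simp: N_def)
    also have "\<dots> = tabor_sum A t u"
      by (rule tabor_sum_eq_sum_lessThan[OF tn, symmetric]) (simp_all add: N_def A_ne)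
    finally show ?thesis
      by (simp only: sum.neutral_const add_0)
  qed
  then have "(\<Union>m. \<Sum>k\<in>{0..m}. tabor_term A t u k) \<preceq> tabor_sum A t u"
    unfolding le_def by blast
  then show ?thesis
    unfolding tabor_transform_def by (rule le_closure_left)
qed

lemma tabor_sum_add_cone_subset:
  fixes B :: "'a::real_vector \<Rightarrow> 'b set"
  assumes t: "t \<in> dyadic_rationals" "0 < t" "t < 1"
    and B_ne: "\<And>k::nat. B ((1 / 2 ^ k) *\<^sub>R u) \<noteq> {}"
    and B_cone: "B u + K \<subseteq> closure (B u)"
  shows "tabor_sum B t u + K \<subseteq> closure (tabor_sum B t u)"
proof -
  obtain j :: int and n :: nat where tn: "t = of_int j / 2 ^ n"
    using t(1) unfolding dyadic_rationals_def by blast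
  have "tabor_term B t u 0 + K \<subseteq> closure (tabor_term B t u 0)"
    unfolding tabor_term_def using B_cone dist_Ints_pos[OF t(2,3)]
    by (intro scaleR_add_cone_subset) simp_all
  then have absorb: "T + tabor_term B t u 0 + K \<subseteq> closure (T + tabor_term B t u 0)" for T
    by (intro le_add_absorb) (simp_all only: le_def closure_subset)
  \<comment> \<open>With \<open>Suc n\<close> terms the summand \<open>k = 0\<close> is always
    present and can be split off.\<close>
  have "tabor_sum B t u = (\<Sum>k<Suc n. tabor_term B t u k)"
    by (rule tabor_sum_eq_sum_lessThan[OF tn]) (simp_all add: B_ne)
  also have "\<dots> = (\<Sum>k<n. tabor_term B t u (Suc k)) + tabor_term B t u 0"
    by (simp only: sum.lessThan_Suc_shift add.commute)
  finally show ?thesis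
    by (simp only: absorb)
qed

end

theorem theorem4:
  fixes D :: "'a::real_vector set"
    and A B F :: "'a \<Rightarrow> 'b::{real_topological_vector, t2_space} set"
    and K :: "'b set"
  assumes "D \<noteq> {}" and "convex D"
    and "\<And>u. u \<in> difference_set D \<Longrightarrow> A u \<noteq> {}"
    and "\<And>u. u \<in> difference_set D \<Longrightarrow> B u \<noteq> {}"
    and "\<And>x. x \<in> D \<Longrightarrow> F x \<noteq> {}"
    and "K = closure (rec_cone_map D B)"
    and "\<And>u. u \<in> difference_set D \<Longrightarrow> closedly_convex K (B u)"
    and "\<And>x. x \<in> D \<Longrightarrow> closedly_convex K (F x)"
    and "\<And>x y. x \<in> D \<Longrightarrow> y \<in> D \<Longrightarrow>
      F ((1/2) *\<^sub>R (x + y)) + A (x - y) \<subseteq> closure ((1/2) *\<^sub>S (F x + F y) + B (x - y))"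
  shows "(\<forall>x\<in>D. \<forall>y\<in>D. \<forall>t \<in> dyadic_rationals \<inter> {0..1}.
      F (t *\<^sub>R x + (1 - t) *\<^sub>R y) + tabor_sum A t (x - y)
        \<subseteq> closure (t *\<^sub>S F x + (1 - t) *\<^sub>S F y + tabor_sum B t (x - y))) \<and>
    ((\<forall>u\<in>difference_set D. 0 \<in> closure (A u + K)) \<longrightarrow>
      (\<forall>x\<in>D. \<forall>y\<in>D. \<forall>t \<in> dyadic_rationals \<inter> {0..1}.
        F (t *\<^sub>R x + (1 - t) *\<^sub>R y) + tabor_transform A t (x - y)
          \<subseteq> closure (t *\<^sub>S F x + (1 - t) *\<^sub>S F y + tabor_transform B t (x - y))))"
proof -
  interpret convex_cone_order K
    by unfold_locales
      (simp add: assms(6) convex_cone_closure_topological convex_cone_rec_cone_map)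
  have u: "(1 / 2 ^ k) *\<^sub>R (x - y) \<in> difference_set D" if "x \<in> D" "y \<in> D" for x y and k :: nat
    using that by (intro difference_set_scaleR[OF assms(2)]) (auto simp: difference_set_def)
  \<comment> \<open>Covers the whole unit interval, but still with the cone on the right.\<close>
  have le: "F (t *\<^sub>R x + (1 - t) *\<^sub>R y) + tabor_sum A t (x - y)
      \<preceq> t *\<^sub>S F x + (1 - t) *\<^sub>S F y + tabor_sum B t (x - y)"
    if xy: "x \<in> D" "y \<in> D" and t: "t \<in> dyadic_rationals \<inter> {0..1}" for x y t
  proof -
    obtain j :: int and n :: nat where tn: "t = of_int j / 2 ^ n"
      using t unfolding dyadic_rationals_def by blast
    have "tabor_sum A t (x - y) = (\<Sum>k<n. tabor_term A t (x - y) k)"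
      by (rule tabor_sum_eq_sum_lessThan[OF tn order_refl]) (intro assms(3) u xy)
    moreover have "tabor_sum B t (x - y) = (\<Sum>k<n. tabor_term B t (x - y) k)"
      by (rule tabor_sum_eq_sum_lessThan[OF tn order_refl]) (intro assms(4) u xy)
    ultimately show ?thesis
      using tabor_partial_sum_le[OF assms(2,4,5,7,8) le_closureI[OF assms(9)] xy tn] t by simp
  qed
  have absorb: "S \<subseteq> closure (T + tabor_sum B t (x - y))"
    if "x \<in> D" "y \<in> D" "t \<in> dyadic_rationals" "0 < t" "t < 1" "S \<preceq> T + tabor_sum B t (x - y)"
    for x y t S T
  proof (rule le_add_absorb[OF that(6) tabor_sum_add_cone_subset[OF that(3-5)]])
    show "B ((1 / 2 ^ k) *\<^sub>R (x - y)) \<noteq> {}" for k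
      by (intro assms(4) u that)
    show "B (x - y) + K \<subseteq> closure (B (x - y))"
      using closure_rec_cone_map_add_subset[OF u[OF that(1,2), of 0], of B]
      by (simp add: assms(6) add.commute)
  qed
  \<comment> \<open>At the endpoints no summand of \<open>B\<close> has a positive coefficient to
    absorb \<open>K\<close>, so the two sides are compared directly.\<close>
  have endpoint: "F (t *\<^sub>R x + (1 - t) *\<^sub>R y) = t *\<^sub>S F x + (1 - t) *\<^sub>S F y"
    if "x \<in> D" "y \<in> D" "t = 0 \<or> t = 1" for x y and t :: real
    using that(3) set_scaleR_zero_left[OF assms(5)[OF that(1)]]
      set_scaleR_zero_left[OF assms(5)[OF that(2)]] by auto
  have "F (t *\<^sub>R x + (1 - t) *\<^sub>R y) + tabor_sum A t (x - y)
      \<subseteq> closure (t *\<^sub>S F x + (1 - t) *\<^sub>S F y + tabor_sum B t (x - y))"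
    if xy: "x \<in> D" "y \<in> D" and t: "t \<in> dyadic_rationals \<inter> {0..1}" for x y t
  proof (cases "t = 0 \<or> t = 1")
    case True
    then obtain j :: int where "t = of_int j / 2 ^ 0"
      by (metis div_by_1 of_int_0 of_int_1 power_0)
    then have "tabor_sum S t (x - y) = 0" if "\<And>u. u \<in> difference_set D \<Longrightarrow> S u \<noteq> {}"
      for S :: "'a \<Rightarrow> 'b set"
    proof -
      have "tabor_sum S t (x - y) = (\<Sum>k<0. tabor_term S t (x - y) k)"
        by (rule tabor_sum_eq_sum_lessThan[OF \<open>t = of_int j / 2 ^ 0\<close> order_refl]) (intro that u xy)
      then show ?thesis
        by simp
    qed
    then show ?thesis
      by (simp add: endpoint[OF xy True] assms(3,4) closure_subset del: set_zero)
  next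
    case False
    then show ?thesis
      using xy t by (intro absorb le) auto
  qed
  moreover have "F (t *\<^sub>R x + (1 - t) *\<^sub>R y) + tabor_transform A t (x - y)
      \<subseteq> closure (t *\<^sub>S F x + (1 - t) *\<^sub>S F y + tabor_transform B t (x - y))"
    if A_0: "\<forall>u\<in>difference_set D. 0 \<in> closure (A u + K)"
      and xy: "x \<in> D" "y \<in> D" and t: "t \<in> dyadic_rationals \<inter> {0..1}" for x y t
  proof (cases "t = 0 \<or> t = 1")
    case True
    then obtain j :: int where "t = of_int j"
      by (metis of_int_0 of_int_1)
    then have "tabor_transform S t (x - y) = 0" if "\<And>u. u \<in> difference_set D \<Longrightarrow> S u \<noteq> {}"
      for S :: "'a \<Rightarrow> 'b set"
    proof -
      have "tabor_transform S (of_int j) (x - y) = closure 0"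
        by (rule tabor_transform_of_int) (intro that u xy)
      \<comment> \<open>Here the Hausdorff property makes the singleton \<open>{0}\<close>
        closed.\<close>
      then show ?thesis
        using \<open>t = of_int j\<close> by (simp add: set_zero)
    qed
    then show ?thesis
      by (simp add: endpoint[OF xy True] assms(3,4) closure_subset del: set_zero)
  next
    case False
    \<comment> \<open>Reduces the transformation of \<open>A\<close> to the finite sum, to which
      \<open>le\<close> applies; the cone is absorbed only after both steps.\<close>
    have "tabor_transform A t (x - y) \<preceq> tabor_sum A t (x - y)"
      using t A_0 u[OF xy] assms(3) by (intro tabor_transform_le_tabor_sum) auto
    then have "F (t *\<^sub>R x + (1 - t) *\<^sub>R y) + tabor_transform A t (x - y)
        \<preceq> F (t *\<^sub>R x + (1 - t) *\<^sub>R y) + tabor_sum A t (x - y)"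
      by (intro le_add le_refl)
    also note le[OF xy t]
    finally have "F (t *\<^sub>R x + (1 - t) *\<^sub>R y) + tabor_transform A t (x - y)
        \<subseteq> closure (t *\<^sub>S F x + (1 - t) *\<^sub>S F y + tabor_sum B t (x - y))"
      using xy t False by (intro absorb) auto
    also have "\<dots> \<subseteq> closure (t *\<^sub>S F x + (1 - t) *\<^sub>S F y + tabor_transform B t (x - y))"
      using t assms(4)[OF u[OF xy]]
      by (intro closure_mono set_plus_mono2 order_refl tabor_sum_subset_tabor_transform) auto
    finally show ?thesis .
  qed
  ultimately show ?thesis
    by blast
qed

end
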